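(* (i) Let $\lambda$ be an integer partition of $k$ and $n\ge0$, and let $g_\lambda(n)$ be the number of vacillating tableaux of shape $\lambda$ and length $2n$. Then \[ g_\lambda(n)=B(n,k)\,f^\lambda, \] where $f^\lambda$ is the number of standard Young tableaux of shape $\lambda$ with content $[k]$, and $B(n,k)$ is the number of partitions of $[n]$ with $k$ of their blocks distinguished. (ii) For every $k\ge0$, \[ \sum_{n\ge0}B(n,k)\frac{x^n}{n!}=\frac{1}{k!}(e^x-1)^k\exp(e^x-1). \]
   Context: Young's lattice is the set of all integer partitions ordered by inclusion of Young diagrams. A vacillating tableau of shape $\lambda$ and length $2n$ is a sequence $\lambda^0,\lambda^1,\dots,\lambda^{2n}$ of integer partitions with $\lambda^0=\emptyset$, $\lambda^{2n}=\lambda$, such that for each $i$, $\lambda^{2i+1}$ is obtained from $\lambda^{2i}$ either by doing nothing ($\lambda^{2i+1}=\lambda^{2i}$) or by deleting one square, and $\lambda^{2i}$ is obtained from $\lambda^{2i-1}$ either by doing nothing or by adding one square. A partition of $[n]$ with $k$ blocks distinguished means a set partition of $[n]$ together with a choice of $k$ of its blocks. *)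

theory Defs
  imports
    "HOL-Library.FuncSet"
    "HOL-Library.Disjoint_Sets"
    "HOL-Computational_Algebra.Formal_Power_Series"
begin

text \<open>Parts are listed in weakly decreasing order without zeros, so that distinct lists
  are distinct integer partitions and the empty partition is \<^term>\<open>[]\<close>.\<close>

definition int_partition :: "nat list \<Rightarrow> bool" where
  "int_partition lam \<longleftrightarrow> sorted_wrt (\<ge>) lam \<and> 0 \<notin> set lam"

definition int_partition_of :: "nat list \<Rightarrow> nat \<Rightarrow> bool" where
  "int_partition_of lam k \<longleftrightarrow> int_partition lam \<and> sum_list lam = k"

text \<open>Squares are pairs (row, column), both counted from 0.\<close>

definition young_diagram :: "nat list \<Rightarrow> (nat \<times> nat) set" where
  "young_diagram lam = {(i, j). i < length lam \<and> j < lam ! i}"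

definition adds_square :: "nat list \<Rightarrow> nat list \<Rightarrow> bool" where
  "adds_square \<mu> lam \<longleftrightarrow>
     (\<exists>c. c \<notin> young_diagram \<mu> \<and> young_diagram lam = insert c (young_diagram \<mu>))"

text \<open>A sequence of length \<open>2n\<close> has terms indexed by \<open>0, \<dots>, 2n\<close>, so the list has \<open>2n + 1\<close> entries.\<close>

definition vacillating_tableaux :: "nat list \<Rightarrow> nat \<Rightarrow> nat list list set" where
  "vacillating_tableaux lam n =
     {L. length L = 2 * n + 1 \<and> (\<forall>\<mu>\<in>set L. int_partition \<mu>) \<and>
         L ! 0 = [] \<and> L ! (2 * n) = lam \<and>
         (\<forall>i<n. L ! (2 * i + 1) = L ! (2 * i) \<or>
                adds_square (L ! (2 * i + 1)) (L ! (2 * i))) \<and>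
         (\<forall>i\<in>{1..n}. L ! (2 * i) = L ! (2 * i - 1) \<or>
                adds_square (L ! (2 * i - 1)) (L ! (2 * i)))}"

definition num_vacillating :: "nat list \<Rightarrow> nat \<Rightarrow> nat" where
  "num_vacillating lam n = card (vacillating_tableaux lam n)"

text \<open>Fillings are extensional (\<^term>\<open>undefined\<close> off the diagram), so that each tableau is
  counted once.\<close>

definition standard_young_tableaux :: "nat list \<Rightarrow> (nat \<times> nat \<Rightarrow> nat) set" where
  "standard_young_tableaux lam =
     {T \<in> extensional (young_diagram lam).
        bij_betw T (young_diagram lam) {1..sum_list lam} \<and>
        (\<forall>i j j'. j < j' \<longrightarrow> (i, j) \<in> young_diagram lam \<longrightarrow> (i, j') \<in> young_diagram lam \<longrightarrow>
           T (i, j) < T (i, j')) \<and>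
        (\<forall>i i' j. i < i' \<longrightarrow> (i, j) \<in> young_diagram lam \<longrightarrow> (i', j) \<in> young_diagram lam \<longrightarrow>
           T (i, j) < T (i', j))}"

definition num_SYT :: "nat list \<Rightarrow> nat" where
  "num_SYT lam = card (standard_young_tableaux lam)"

definition num_distinguished :: "nat \<Rightarrow> nat \<Rightarrow> nat" where
  "num_distinguished n k = card {(P, S). partition_on {1..n} P \<and> S \<subseteq> P \<and> card S = k}"

end

theory Submission
  imports Defs
begin

text \<open>Let \<open>U\<close> and \<open>D\<close> be the operators on Young's lattice that add and delete a square. Two steps of
  a vacillating tableau apply \<open>I + D\<close> and then \<open>I + U\<close>. Since \<open>f\<^sup>\<lambda>\<close> is the sum of \<open>f\<^sup>\<mu>\<close> over \<open>\<mu>\<close>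
  covered by \<open>\<lambda>\<close>, the relation \<open>D U = U D + I\<close> makes the sum of \<open>f\<^sup>\<nu>\<close> over \<open>\<nu>\<close> covering \<open>\<mu>\<close> equal
  to \<open>(|\<mu>| + 1) f\<^sup>\<mu>\<close>. Hence \<open>B(n, |\<lambda>|) f\<^sup>\<lambda>\<close> satisfies the recursion of \<open>g\<^sub>\<lambda>(n)\<close> as soon as
  \<open>B(n+1, k) = B(n, k-1) + (k+1) B(n, k) + (k+1) B(n, k+1)\<close>, which holds by considering the block
  of \<open>n+1\<close>. Differentiating \<open>(e\<^sup>x - 1)\<^sup>k exp (e\<^sup>x - 1) / k!\<close> gives the same recursion for its
  coefficients.\<close>

section \<open>Partitions with distinguished blocks\<close>

lemma partition_on_Diff_block:
  assumes P: "partition_on A P" and b: "b \<in> P"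
  shows "partition_on (A - b) (P - {b})"
proof -
  have "disjnt b (\<Union>(P - {b}))"
    using partition_onD2[OF P] b by (auto simp: disjnt_iff disjoint_def)
  moreover have "insert b (P - {b}) = P" using b by auto
  ultimately show ?thesis using partition_on_insert[of b "P - {b}" A] P by simp
qed

text \<open>The choice \<open>b = {}\<close> stands for the new singleton block.\<close>

lemma bij_betw_partition_on_insert:
  assumes x: "x \<notin> A"
  shows "bij_betw (\<lambda>(P, b). insert (insert x b) (P - {b}))
           (SIGMA P:{P. partition_on A P}. insert {} P) {P. partition_on (insert x A) P}"
    (is "bij_betw ?f ?S ?T")
proof -
  \<comment> \<open>The inverse takes \<open>x\<close> out of its block \<open>B\<close>. The union
    over the one-element set of blocks containing \<open>x\<close> picks \<open>B\<close>, and
    subtracting \<open>{{}}\<close> drops what is left of \<open>B\<close> when \<open>x\<close> was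
    a singleton block.\<close>
  define g where "g P = (let B = \<Union>{B \<in> P. x \<in> B} in (insert (B - {x}) (P - {B}) - {{}}, B - {x}))" for P
  have block: "\<Union>{C \<in> P. x \<in> C} = B" if "partition_on (insert x A) P" "B \<in> P" "x \<in> B" for P B
    using partition_onD2[OF that(1)] that(2,3) unfolding disjoint_def by blast
  show ?thesis
  proof (rule bij_betw_byWitness[where f' = g])
    show "\<forall>a\<in>?S. g (?f a) = a"
    proof
      fix a assume "a \<in> ?S"
      then obtain P b where a: "a = (P, b)" and P: "partition_on A P" and b: "b \<in> insert {} P"
        by blast
      have nin: "x \<notin> C" if "C \<in> insert {} P" for C
        using that x partition_onD1[OF P] by auto
      have ne: "{} \<notin> P" using P by (rule partition_onD3)
      have "\<Union>{B \<in> ?f (P, b). x \<in> B} = insert x b" using nin by auto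
      moreover have "insert x b - {x} = b" using nin[OF b] by simp
      moreover have "insert b (?f (P, b) - {insert x b}) - {{}} = P"
        using b nin ne by auto
      ultimately show "g (?f a) = a" by (simp add: a g_def Let_def)
    qed
    show "\<forall>P\<in>?T. ?f (g P) = P"
    proof clarify
      fix P assume P: "partition_on (insert x A) P"
      obtain B where B: "B \<in> P" "x \<in> B" using partition_onD1[OF P] by auto
      \<comment> \<open>Otherwise this set would be a nonempty block contained in the different
        block \<open>B\<close>. It is therefore new to \<open>P - {B}\<close>, and taking it away
        again restores exactly \<open>P - {B}\<close>.\<close>
      have "B - {x} \<notin> P"
      proof
        assume *: "B - {x} \<in> P"
        have "B - {x} \<noteq> B" using B(2) by blast
        then have "(B - {x}) \<inter> B = {}"
          by (rule disjointD[OF partition_onD2[OF P] * B(1)])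
        then have "B - {x} = {}" by blast
        then show False using * partition_onD3[OF P] by metis
      qed
      moreover have "insert b Q - {{}} - {b} = Q" if "b \<notin> Q" "{} \<notin> Q" for b :: "'a set" and Q
        using that by auto
      ultimately have "insert (B - {x}) (P - {B}) - {{}} - {B - {x}} = P - {B}"
        using partition_onD3[OF P] by simp
      moreover have "insert x (B - {x}) = B" using B(2) by blast
      ultimately show "?f (g P) = P"
        using B(1) unfolding g_def block[OF P B] Let_def by (simp add: insert_absorb)
    qed
    show "?f ` ?S \<subseteq> ?T"
    proof (intro image_subsetI)
      fix a assume "a \<in> ?S"
      then obtain P b where a: "a = (P, b)" and P: "partition_on A P" and b: "b \<in> insert {} P"
        by blast
      have "partition_on (A - b) (P - {b})" "b \<subseteq> A"
        using b P partition_on_Diff_block[OF P, of b] partition_onD1[OF P] partition_onD3[OF P] by auto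
      moreover from this have "disjnt (insert x b) (\<Union>(P - {b}))"
        using x partition_onD1[of "A - b" "P - {b}"] by (simp add: disjnt_iff) blast
      moreover have "insert x A - insert x b = A - b" using x by blast
      ultimately have "partition_on (insert x A) (insert (insert x b) (P - {b}))"
        by (subst partition_on_insert) auto
      then show "?f a \<in> ?T" by (simp add: a)
    qed
    show "g ` ?T \<subseteq> ?S"
    proof (intro image_subsetI)
      fix P assume "P \<in> ?T"
      then have P: "partition_on (insert x A) P" by simp
      obtain B where B: "B \<in> P" "x \<in> B" using partition_onD1[OF P] by auto
      have Q: "partition_on (insert x A - B) (P - {B})" by (rule partition_on_Diff_block[OF P B(1)])
      have BA: "B - {x} \<subseteq> A" "insert x A - B = A - (B - {x})"
        using partition_onD1[OF P] B x by auto
      have "partition_on A (insert (B - {x}) (P - {B}) - {{}})"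
      proof (cases "B - {x} = {}")
        case True
        then show ?thesis using Q partition_onD3[OF Q] unfolding BA(2) True by simp
      next
        case False
        have "disjnt (B - {x}) (\<Union>(P - {B}))" using partition_onD1[OF Q] by (auto simp: disjnt_iff)
        then have "partition_on A (insert (B - {x}) (P - {B}))"
          using Q BA False by (subst partition_on_insert) auto
        then show ?thesis using partition_onD3[of A] by (simp only: Diff_insert0 Diff_empty not_False_eq_True)
      qed
      then show "g P \<in> ?S" using block[OF P B] by (auto simp: g_def Let_def)
    qed
  qed
qed

text \<open>The element \<open>x\<close> either becomes a singleton, which raises the number of
  blocks by one, or joins one of the \<open>card P\<close> blocks, which leaves it unchanged. Any
  weight depending only on the number of blocks therefore transforms in this way.\<close>

lemma sum_partition_on_insert:
  fixes \<phi> :: "nat \<Rightarrow> nat"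
  assumes A: "finite A" and x: "x \<notin> A"
  shows "(\<Sum>P | partition_on (insert x A) P. \<phi> (card P)) =
         (\<Sum>P | partition_on A P. \<phi> (Suc (card P)) + card P * \<phi> (card P))"
proof -
  have finP: "finite P" if "partition_on A P" for P using finite_elements[OF A that] .
  have "(\<Sum>P | partition_on (insert x A) P. \<phi> (card P)) =
      (\<Sum>(P, b)\<in>(SIGMA P:{P. partition_on A P}. insert {} P). \<phi> (card (insert (insert x b) (P - {b}))))"
    by (subst sum.reindex_bij_betw[OF bij_betw_partition_on_insert[OF x], symmetric])
       (simp add: case_prod_unfold)
  also have "\<dots> = (\<Sum>P | partition_on A P. \<Sum>b\<in>insert {} P. \<phi> (card (insert (insert x b) (P - {b}))))"
    using finitely_many_partition_on[OF A] finP by (subst sum.Sigma) auto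
  also have "\<dots> = (\<Sum>P | partition_on A P. \<phi> (Suc (card P)) + card P * \<phi> (card P))"
  proof (rule sum.cong[OF refl])
    fix P assume "P \<in> {P. partition_on A P}"
    then have P: "partition_on A P" by simp
    have nin: "insert x b \<notin> P" for b using x partition_onD1[OF P] by auto
    have ne: "{} \<notin> P" using P by (rule partition_onD3)
    have "card (insert (insert x b) (P - {b})) = card P" if "b \<in> P" for b
      using that nin finP[OF P] card_Suc_Diff1[of P b] by simp
    then have "(\<Sum>b\<in>P. \<phi> (card (insert (insert x b) (P - {b})))) = card P * \<phi> (card P)" by simp
    then show "(\<Sum>b\<in>insert {} P. \<phi> (card (insert (insert x b) (P - {b})))) =
        \<phi> (Suc (card P)) + card P * \<phi> (card P)"
      using finP[OF P] ne nin by simp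
  qed
  finally show ?thesis .
qed

section \<open>Values and recursion of \<open>B(n, k)\<close>\<close>

lemma num_distinguished_eq_sum:
  "num_distinguished n k = (\<Sum>P | partition_on {1..n} P. card P choose k)"
proof -
  have fin: "finite P" if "partition_on {1..n} P" for P using finite_elements[OF _ that] by simp
  have "{(P, S). partition_on {1..n} P \<and> S \<subseteq> P \<and> card S = k} =
      (SIGMA P:{P. partition_on {1..n} P}. {S. S \<subseteq> P \<and> card S = k})" by auto
  also have "card \<dots> = (\<Sum>P | partition_on {1..n} P. card {S. S \<subseteq> P \<and> card S = k})"
    using fin finitely_many_partition_on[of "{1..n}"] by (subst card_SigmaI) auto
  also have "\<dots> = (\<Sum>P | partition_on {1..n} P. card P choose k)"
    using fin by (intro sum.cong) (auto simp: n_subsets)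
  finally show ?thesis by (simp add: num_distinguished_def)
qed

lemma num_distinguished_0: "num_distinguished 0 k = (if k = 0 then 1 else 0)"
proof -
  have "{P. partition_on {1..0::nat} P} = {{}}" by (auto simp: partition_on_def)
  then show ?thesis by (auto simp: num_distinguished_eq_sum)
qed

text \<open>Split the factor \<open>m\<close> as \<open>k + (m - k)\<close>. A
  \<open>k\<close>-subset with a marked element outside it is the same as a
  \<open>(k+1)\<close>-subset with a marked element inside it, which accounts for the second
  summand.\<close>

lemma times_binomial_eq: "m * (m choose k) = k * (m choose k) + Suc k * (m choose Suc k)"
proof (cases "k \<le> m")
  case True
  then show ?thesis
    using binomial_absorb_comp[of m k] binomial_absorption[of k m]
    by (metis add_mult_distrib binomial_absorption diff_Suc_1 le_add_diff_inverse)
qed (simp add: binomial_eq_0)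

lemma num_distinguished_Suc:
  "num_distinguished (Suc n) k =
     (if k = 0 then 0 else num_distinguished n (k - 1)) +
     Suc k * num_distinguished n k + Suc k * num_distinguished n (Suc k)"
proof -
  \<comment> \<open>Pascal's rule expands the first binomial and \<open>times_binomial_eq\<close>
    the second product. The case \<open>k = 0\<close> is kept apart because truncated subtraction
    would read \<open>k - 1\<close> as \<open>0\<close>.\<close>
  have step: "(Suc m choose k) + m * (m choose k) =
      (if k = 0 then 0 else m choose (k - 1)) + Suc k * (m choose k) + Suc k * (m choose Suc k)" for m
    using times_binomial_eq[of m k] by (cases k) auto
  have "num_distinguished (Suc n) k =
      (\<Sum>P | partition_on (insert (Suc n) {1..n}) P. card P choose k)"
    by (simp add: num_distinguished_eq_sum atLeastAtMostSuc_conv)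
  also have "\<dots> = (\<Sum>P | partition_on {1..n} P. (Suc (card P) choose k) + card P * (card P choose k))"
    by (rule sum_partition_on_insert) auto
  finally show ?thesis
    by (simp add: step num_distinguished_eq_sum sum.distrib sum_distrib_left del: mult_Suc)
qed

section \<open>The exponential generating function\<close>

lemma fps_num_distinguished:
  "Abs_fps (\<lambda>n. of_nat (num_distinguished n k) / fact n :: 'a::field_char_0) =
     fps_const (1 / fact k) * (fps_exp 1 - 1) ^ k * (fps_exp 1 oo (fps_exp 1 - 1))"
proof -
  \<comment> \<open>With \<open>u = e^x - 1\<close> and \<open>E = exp u\<close>, the derivatives
    \<open>u' = u + 1\<close> and \<open>E' = E (u + 1)\<close> stay polynomial in \<open>u\<close>
    and \<open>E\<close>.\<close>
  define u :: "'a fps" where "u = fps_exp 1 - 1"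
  define E where "E = fps_exp 1 oo u"
  define G where "G k = fps_const (1 / fact k) * u ^ k * E" for k
  have u0: "fps_nth u 0 = 0" by (simp add: u_def)
  have du: "fps_deriv u = u + 1" by (simp add: u_def)
  have dE: "fps_deriv E = E * (u + 1)" using u0 by (simp add: E_def fps_compose_deriv du)
  \<comment> \<open>Multiplication by \<open>u\<close> raises the index, so every factor
    \<open>u\<close> produced by differentiation can be absorbed into some \<open>G\<close>.\<close>
  have G_Suc: "of_nat (Suc k) * G (Suc k) = u * G k" for k
    by (simp add: G_def fps_of_nat[symmetric] mult.assoc[symmetric] del: of_nat_Suc)
  have dG: "fps_deriv (G k) = (if k = 0 then 0 else G (k - 1)) + of_nat (Suc k) * G k
      + of_nat (Suc k) * G (Suc k)" for k
  proof (cases k)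
    case 0
    then show ?thesis unfolding G_Suc by (simp add: G_def dE algebra_simps)
  next
    case (Suc l)
    have c: "fps_const (1 / fact k) * of_nat k = (fps_const (1 / fact l) :: 'a fps)"
      by (simp add: Suc fps_of_nat[symmetric] del: of_nat_Suc)
    have dp: "fps_deriv (u ^ k) = of_nat k * u ^ l * (u + 1)"
      unfolding fps_deriv_power du by (simp add: Suc fps_of_nat[symmetric] mult_ac del: of_nat_Suc)
    \<comment> \<open>By the product rule the power contributes \<open>G l * (u + 1)\<close> and
      \<open>E\<close> contributes \<open>G k * (u + 1)\<close>, where \<open>k = Suc l\<close>.
      Here \<open>u * G l = k * G k\<close> and \<open>u * G k = (k + 1) * G (k + 1)\<close>, so the
      two copies of \<open>G k\<close> terms add up to the factor \<open>k + 1\<close>.\<close>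
    have "fps_deriv (G k) = fps_const (1 / fact k) * of_nat k * u ^ l * (u + 1) * E + G k * (u + 1)"
      unfolding G_def by (simp add: dE dp algebra_simps)
    also have "\<dots> = G l * (u + 1) + G k * (u + 1)"
      unfolding c by (simp add: G_def algebra_simps)
    also have "\<dots> = G l + (G k + of_nat (Suc l) * G (Suc l)) + u * G k"
      unfolding G_Suc by (simp add: algebra_simps)
    also have "\<dots> = G l + of_nat (Suc k) * G k + of_nat (Suc k) * G (Suc k)"
      unfolding G_Suc using Suc G_Suc[of l] by (simp add: algebra_simps)
    finally show ?thesis using Suc by simp
  qed
  \<comment> \<open>The differential equation read at coefficient \<open>n\<close> determines
    coefficient \<open>n + 1\<close> by the recursion of \<open>num_distinguished\<close>. The start
    agrees since \<open>u\<close> has no constant term.\<close>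
  have "fps_nth (G k) n = of_nat (num_distinguished n k) / fact n" for n k
  proof (induction n arbitrary: k)
    case 0
    then show ?case by (cases k) (auto simp: G_def E_def u0 num_distinguished_0)
  next
    case (Suc n)
    have "of_nat (Suc n) * fps_nth (G k) (Suc n) = fps_nth (fps_deriv (G k)) n" by simp
    also have "\<dots> = of_nat (num_distinguished (Suc n) k) / fact n"
      unfolding dG
      by (simp add: Suc num_distinguished_Suc fps_of_nat[symmetric] add_divide_distrib
            del: of_nat_Suc mult_Suc)
    finally show ?case by (simp add: field_simps del: of_nat_Suc)
  qed
  then show ?thesis by (simp add: fps_eq_iff G_def E_def u_def)
qed

section \<open>Finite order ideals of \<open>\<nat> \<times> \<nat>\<close>\<close>

text \<open>Young diagrams as plain sets: the join and meet of Young's lattice become union and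
  intersection, and covering relations become insertion of one element.\<close>

definition ferrers :: "(nat \<times> nat) set \<Rightarrow> bool" where
  "ferrers X \<longleftrightarrow> finite X \<and> (\<forall>i j i' j'. (i, j) \<in> X \<longrightarrow> i' \<le> i \<longrightarrow> j' \<le> j \<longrightarrow> (i', j') \<in> X)"

definition row :: "(nat \<times> nat) set \<Rightarrow> nat \<Rightarrow> nat" where
  "row X i = card {j. (i, j) \<in> X}"

definition up :: "(nat \<times> nat) set \<Rightarrow> (nat \<times> nat) set set" where
  "up X = {Y. ferrers Y \<and> (\<exists>c. c \<notin> X \<and> Y = insert c X)}"

definition down :: "(nat \<times> nat) set \<Rightarrow> (nat \<times> nat) set set" where
  "down Y = {X. ferrers X \<and> (\<exists>c. c \<notin> X \<and> Y = insert c X)}"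

lemma ferrers_finite: "ferrers X \<Longrightarrow> finite X"
  by (simp add: ferrers_def)

lemma ferrersD: "ferrers X \<Longrightarrow> (i, j) \<in> X \<Longrightarrow> i' \<le> i \<Longrightarrow> j' \<le> j \<Longrightarrow> (i', j') \<in> X"
  unfolding ferrers_def by blast

lemma ferrers_Un: "ferrers X \<Longrightarrow> ferrers Y \<Longrightarrow> ferrers (X \<union> Y)"
  unfolding ferrers_def by (metis Un_iff finite_Un)

lemma ferrers_Int: "ferrers X \<Longrightarrow> ferrers Y \<Longrightarrow> ferrers (X \<inter> Y)"
  unfolding ferrers_def by (metis Int_iff finite_Int)

lemma finite_initial_segment:
  fixes S :: "nat set"
  assumes "finite S" and "\<And>a b. a \<in> S \<Longrightarrow> b \<le> a \<Longrightarrow> b \<in> S"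
  shows "S = {..<card S}"
proof (cases "S = {}")
  case False
  then have "S = {..Max S}" using assms by (auto intro: Max_in)
  then show ?thesis by (metis card_atMost lessThan_Suc_atMost)
qed simp

text \<open>Each row is a finite initial segment of the naturals, hence determined by its
  size.\<close>

lemma mem_iff_row:
  assumes "ferrers X"
  shows "(i, j) \<in> X \<longleftrightarrow> j < row X i"
proof -
  have "{j. (i, j) \<in> X} = {..<row X i}"
    unfolding row_def
  proof (rule finite_initial_segment)
    show "finite {j. (i, j) \<in> X}"
      using finite_imageI[OF ferrers_finite[OF assms], of snd] by (rule finite_subset[rotated]) force
  qed (auto intro: ferrersD[OF assms])
  then show ?thesis by blast
qed

lemma row_antimono:
  assumes X: "ferrers X" and "i \<le> i'"
  shows "row X i' \<le> row X i"
proof (rule ccontr)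
  assume "\<not> row X i' \<le> row X i"
  then have "(i', row X i) \<in> X" using mem_iff_row[OF X] by simp
  then have "(i, row X i) \<in> X" by (rule ferrersD[OF X]) (use assms in auto)
  then show False using mem_iff_row[OF X] by simp
qed

text \<open>Closure to the left forces a new square into the first free column of its row, and
  closure upwards requires the row above to reach that column. Row 0 has no row above it.\<close>

lemma up_eq_image:
  assumes X: "ferrers X"
  shows "up X = (\<lambda>i. insert (i, row X i) X) ` {i. i = 0 \<or> row X i < row X (i - 1)}"
proof (intro equalityI subsetI)
  fix Y assume "Y \<in> up X"
  then obtain i j where Y: "ferrers Y" "(i, j) \<notin> X" "Y = insert (i, j) X"
    unfolding up_def by auto
  have "row X i \<le> j" using Y(2) mem_iff_row[OF X] by simp
  moreover have "(i, row X i) \<in> Y" using ferrersD[OF Y(1)] Y(3) \<open>row X i \<le> j\<close> by blast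
  ultimately have j: "j = row X i" using Y(3) mem_iff_row[OF X] by auto
  have "row X i < row X (i - 1)" if "i \<noteq> 0"
  proof -
    have "(i - 1, j) \<in> Y" using ferrersD[OF Y(1), of i j "i - 1" j] Y(3) by simp
    then show ?thesis using Y(3) that mem_iff_row[OF X] j by auto
  qed
  then show "Y \<in> (\<lambda>i. insert (i, row X i) X) ` {i. i = 0 \<or> row X i < row X (i - 1)}"
    using Y(3) j by auto
next
  fix Y assume "Y \<in> (\<lambda>i. insert (i, row X i) X) ` {i. i = 0 \<or> row X i < row X (i - 1)}"
  then obtain i where i: "i = 0 \<or> row X i < row X (i - 1)" and Y: "Y = insert (i, row X i) X" by auto
  have "(i', j') \<in> Y" if "i' \<le> i" "j' \<le> row X i" for i' j'
  proof (cases "i' = i")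
    case True
    then show ?thesis using that Y mem_iff_row[OF X] by auto
  next
    case False
    then have "i' \<le> i - 1" "i \<noteq> 0" using that by auto
    then have "j' < row X i'" using i that row_antimono[OF X] by fastforce
    then show ?thesis using Y mem_iff_row[OF X] by simp
  qed
  moreover have "(i', j') \<in> Y" if "(a, b) \<in> X" "i' \<le> a" "j' \<le> b" for a b i' j'
    using ferrersD[OF X that] Y by simp
  ultimately have "ferrers Y" using ferrers_finite[OF X] unfolding ferrers_def by (auto simp: Y)
  then show "Y \<in> up X" using Y mem_iff_row[OF X] unfolding up_def by auto
qed

text \<open>A removable square must be the last of its row with nothing below it. The strict
  inequality also makes row \<open>i\<close> nonempty, so that \<open>row X i - 1\<close> is a
  genuine column.\<close>

lemma down_eq_image:
  assumes X: "ferrers X"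
  shows "down X = (\<lambda>i. X - {(i, row X i - 1)}) ` {i. row X (Suc i) < row X i}"
proof (intro equalityI subsetI)
  fix Y assume "Y \<in> down X"
  then obtain i j where Y: "ferrers Y" "(i, j) \<notin> Y" "X = insert (i, j) Y"
    unfolding down_def by auto
  have j: "j < row X i" using Y(3) mem_iff_row[OF X] by blast
  have "(i, Suc j) \<notin> X" using ferrersD[OF Y(1), of i "Suc j" i j] Y by auto
  then have j': "j = row X i - 1" using j mem_iff_row[OF X] by simp
  have "(Suc i, j) \<notin> X" using ferrersD[OF Y(1), of "Suc i" j i j] Y by auto
  then have "row X (Suc i) < row X i" using j mem_iff_row[OF X] by simp
  moreover have "Y = X - {(i, row X i - 1)}" using Y(2,3) unfolding j' by blast
  ultimately show "Y \<in> (\<lambda>i. X - {(i, row X i - 1)}) ` {i. row X (Suc i) < row X i}" by blast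
next
  fix Y assume "Y \<in> (\<lambda>i. X - {(i, row X i - 1)}) ` {i. row X (Suc i) < row X i}"
  then obtain i where i: "row X (Suc i) < row X i" and Y: "Y = X - {(i, row X i - 1)}" by blast
  \<comment> \<open>No other square of \<open>X\<close> lies weakly below and to the right of the
    corner, so its removal cannot break closure.\<close>
  have corner: "(a, b) \<notin> X - {(i, row X i - 1)}" if "i \<le> a" "row X i - 1 \<le> b" for a b
  proof (cases "a = i")
    case True
    then show ?thesis using that(2) mem_iff_row[OF X] by auto
  next
    case False
    then have "row X a \<le> row X (Suc i)" using that(1) by (intro row_antimono[OF X]) simp
    then show ?thesis using that(2) i mem_iff_row[OF X, of a b] by simp
  qed
  have "(i', j') \<in> Y" if "(a, b) \<in> Y" "i' \<le> a" "j' \<le> b" for a b i' j'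
  proof -
    have "(i', j') \<noteq> (i, row X i - 1)" using corner that unfolding Y by blast
    moreover have "(i', j') \<in> X" using ferrersD[OF X _ that(2,3)] that(1) Y by blast
    ultimately show ?thesis using Y by blast
  qed
  moreover have "finite Y" using ferrers_finite[OF X] Y by simp
  ultimately have "ferrers Y" unfolding ferrers_def by blast
  moreover have "(i, row X i - 1) \<in> X" using i mem_iff_row[OF X] by simp
  ultimately show "Y \<in> down X" unfolding down_def using Y by blast
qed

lemma finite_down_rows:
  assumes "ferrers X" shows "finite {i. row X (Suc i) < row X i}"
proof (rule finite_subset)
  show "{i. row X (Suc i) < row X i} \<subseteq> fst ` X"
  proof
    fix i assume "i \<in> {i. row X (Suc i) < row X i}"
    then have "(i, 0) \<in> X" using mem_iff_row[OF assms] by simp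
    then show "i \<in> fst ` X" by (rule image_eqI[rotated]) simp
  qed
qed (simp add: ferrers_finite[OF assms])

text \<open>Row \<open>i + 1\<close> can be extended exactly when row \<open>i\<close> can be
  shortened: both say that row \<open>i\<close> is strictly longer than row \<open>i + 1\<close>.
  Row 0 is the one extendable row without such a partner.\<close>

lemma up_rows_eq: "{i. i = 0 \<or> row X i < row X (i - 1)} = insert 0 (Suc ` {i. row X (Suc i) < row X i})"
proof (rule set_eqI)
  show "i \<in> {i. i = 0 \<or> row X i < row X (i - 1)} \<longleftrightarrow>
      i \<in> insert 0 (Suc ` {i. row X (Suc i) < row X i})" for i
    by (cases i) (auto simp: image_iff)
qed

lemma finite_up: "ferrers X \<Longrightarrow> finite (up X)"
  using finite_down_rows by (simp only: up_eq_image up_rows_eq finite_imageI finite_insert)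

lemma finite_down: "ferrers X \<Longrightarrow> finite (down X)"
  using finite_down_rows by (simp only: down_eq_image finite_imageI)

text \<open>Squares to add and squares to remove are both indexed by rows, and
  \<open>up_rows_eq\<close> compares the two index sets. The excess of one is the identity term in
  \<open>D U = U D + I\<close>.\<close>

lemma card_up:
  assumes X: "ferrers X"
  shows "card (up X) = Suc (card (down X))"
proof -
  let ?R = "{i. row X (Suc i) < row X i}"
  have "inj_on (\<lambda>i. insert (i, row X i) X) A" for A
    using mem_iff_row[OF X] by (auto simp: inj_on_def insert_eq_iff)
  then have "card (up X) = card (insert 0 (Suc ` ?R))"
    unfolding up_eq_image[OF X] up_rows_eq by (rule card_image)
  also have "\<dots> = Suc (card ?R)" using finite_down_rows[OF X] by (simp add: card_image)
  also have "inj_on (\<lambda>i. X - {(i, row X i - 1)}) ?R"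
  proof (rule inj_onI)
    fix i i' assume *: "i \<in> ?R" "i' \<in> ?R" "X - {(i, row X i - 1)} = X - {(i', row X i' - 1)}"
    then have "(i, row X i - 1) \<in> X" using mem_iff_row[OF X] by simp
    then show "i = i'" using *(3) by blast
  qed
  then have "card ?R = card (down X)"
    unfolding down_eq_image[OF X] by (rule card_image[symmetric])
  finally show ?thesis .
qed

text \<open>This is \<open>D U = U D + I\<close>: off the diagonal, a pair \<open>X\<close>, \<open>Z\<close> is joined through
  \<open>X \<union> Z\<close> above and through \<open>X \<inter> Z\<close> below.\<close>

lemma up_down_sum:
  fixes \<phi> :: "(nat \<times> nat) set \<Rightarrow> nat"
  assumes X: "ferrers X"
  shows "(\<Sum>Y\<in>up X. \<Sum>Z\<in>down Y. \<phi> Z) = \<phi> X + (\<Sum>W\<in>down X. \<Sum>Z\<in>up W. \<phi> Z)"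
proof -
  have fu: "ferrers Y" if "Y \<in> up W" for W Y using that by (simp add: up_def)
  have fd: "ferrers Y" if "Y \<in> down W" for W Y using that by (simp add: down_def)
  have Xd: "X \<in> down Y" if "Y \<in> up X" for Y using that X by (auto simp: up_def down_def)
  have Xu: "X \<in> up Y" if "Y \<in> down X" for Y using that X by (auto simp: up_def down_def)
  \<comment> \<open>Every \<open>Y\<close> above \<open>X\<close> leads back down to
    \<open>X\<close>. Splitting off these diagonal terms gives \<open>card (up X)\<close> copies of
    \<open>\<phi> X\<close>, which is one more than \<open>card (down X)\<close>.\<close>
  have "(\<Sum>Y\<in>up X. \<Sum>Z\<in>down Y. \<phi> Z) = (\<Sum>Y\<in>up X. \<phi> X + (\<Sum>Z\<in>down Y - {X}. \<phi> Z))"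
    using Xd fu finite_down by (intro sum.cong refl sum.remove) auto
  also have "\<dots> = \<phi> X + card (down X) * \<phi> X + (\<Sum>Y\<in>up X. \<Sum>Z\<in>down Y - {X}. \<phi> Z)"
    by (simp add: sum.distrib card_up[OF X])
  also have "(\<Sum>Y\<in>up X. \<Sum>Z\<in>down Y - {X}. \<phi> Z) = (\<Sum>W\<in>down X. \<Sum>Z\<in>up W - {X}. \<phi> Z)"
  proof -
    \<comment> \<open>If \<open>Y\<close> is \<open>X\<close> plus \<open>c\<close> and also
      \<open>Z\<close> plus \<open>d\<close> with \<open>Z \<noteq> X\<close>, then
      \<open>c \<noteq> d\<close>, and \<open>X \<inter> Z\<close> is both \<open>X\<close> without
      \<open>d\<close> and \<open>Z\<close> without \<open>c\<close>.\<close>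
    have 1: "Z \<in> up (X \<inter> Z) - {X} \<and> X \<inter> Z \<in> down X \<and> X \<union> Z = Y"
      if YZ: "Y \<in> up X" "Z \<in> down Y - {X}" for Y Z
    proof -
      obtain c where c: "c \<notin> X" "Y = insert c X" using YZ(1) unfolding up_def by blast
      obtain d where d: "d \<notin> Z" "Y = insert d Z" "ferrers Z" "Z \<noteq> X"
        using YZ(2) unfolding down_def by blast
      have "c \<noteq> d" using c d by (metis insert_ident)
      then have "d \<in> X" "c \<in> Z" using c d by auto
      then have "Z = insert c (X \<inter> Z)" "X = insert d (X \<inter> Z)" "X \<union> Z = Y" using c d by auto
      then show ?thesis using c(1) d(1,3,4) X ferrers_Int[OF X d(3)]
        unfolding up_def down_def by blast
    qed
    \<comment> \<open>Dually, two distinct covers \<open>X\<close> and \<open>Z\<close> of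
      \<open>W\<close> meet in \<open>W\<close>, and their union covers both.\<close>
    have 2: "Z \<in> down (X \<union> Z) - {X} \<and> X \<union> Z \<in> up X \<and> X \<inter> Z = W"
      if WZ: "W \<in> down X" "Z \<in> up W - {X}" for W Z
    proof -
      obtain c where c: "c \<notin> W" "X = insert c W" using WZ(1) unfolding down_def by blast
      obtain d where d: "d \<notin> W" "Z = insert d W" "ferrers Z" "Z \<noteq> X"
        using WZ(2) unfolding up_def by blast
      have "X \<union> Z = insert d X" "X \<union> Z = insert c Z" "d \<notin> X" "c \<notin> Z" "X \<inter> Z = W" using c d by auto
      then show ?thesis using d(3,4) X ferrers_Un[OF X d(3)]
        unfolding up_def down_def by blast
    qed
    have "(\<Sum>Y\<in>up X. \<Sum>Z\<in>down Y - {X}. \<phi> Z) = (\<Sum>(Y, Z)\<in>(SIGMA Y:up X. down Y - {X}). \<phi> Z)"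
      using finite_up[OF X] fu finite_down by (intro sum.Sigma) auto
    also have "\<dots> = (\<Sum>(W, Z)\<in>(SIGMA W:down X. up W - {X}). \<phi> Z)"
      by (rule sum.reindex_bij_witness[where i = "\<lambda>(W, Z). (X \<union> Z, Z)" and j = "\<lambda>(Y, Z). (X \<inter> Z, Z)"])
         (use 1 2 in auto)
    also have "\<dots> = (\<Sum>W\<in>down X. \<Sum>Z\<in>up W - {X}. \<phi> Z)"
      using finite_down[OF X] fd finite_up by (intro sum.Sigma[symmetric]) auto
    finally show ?thesis .
  qed
  \<comment> \<open>The remaining \<open>card (down X)\<close> copies of \<open>\<phi> X\<close> are
    returned, one to each \<open>W\<close>, as the missing term \<open>Z = X\<close> of the sum over
    \<open>up W\<close>.\<close>
  also have "\<phi> X + card (down X) * \<phi> X + (\<Sum>W\<in>down X. \<Sum>Z\<in>up W - {X}. \<phi> Z) =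
      \<phi> X + (\<Sum>W\<in>down X. \<phi> X + (\<Sum>Z\<in>up W - {X}. \<phi> Z))"
    by (simp add: sum.distrib)
  also have "(\<Sum>W\<in>down X. \<phi> X + (\<Sum>Z\<in>up W - {X}. \<phi> Z)) = (\<Sum>W\<in>down X. \<Sum>Z\<in>up W. \<phi> Z)"
    using Xu fd finite_up by (intro sum.cong refl sum.remove[symmetric]) auto
  finally show ?thesis .
qed

section \<open>Standard fillings\<close>

text \<open>The conditions of \<open>standard_young_tableaux\<close> for an arbitrary set of
  squares, so that a square can be removed without passing through lists of parts.\<close>

definition syt :: "(nat \<times> nat) set \<Rightarrow> (nat \<times> nat \<Rightarrow> nat) set" where
  "syt X =
     {T \<in> extensional X.
        bij_betw T X {1..card X} \<and>
        (\<forall>i j j'. j < j' \<longrightarrow> (i, j) \<in> X \<longrightarrow> (i, j') \<in> X \<longrightarrow> T (i, j) < T (i, j')) \<and>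
        (\<forall>i i' j. i < i' \<longrightarrow> (i, j) \<in> X \<longrightarrow> (i', j) \<in> X \<longrightarrow> T (i, j) < T (i', j))}"

lemma syt_le: "T \<in> syt X \<Longrightarrow> c \<in> X \<Longrightarrow> T c \<le> card X"
  using bij_betw_apply[of T X "{1..card X}" c] by (simp add: syt_def)

lemma syt_undefined: "T \<in> syt X \<Longrightarrow> c \<notin> X \<Longrightarrow> T c = undefined"
  using extensional_arb[of T X c] by (simp add: syt_def)

lemma card_syt_empty: "card (syt {}) = 1"
  by (simp add: syt_def bij_betw_def)

lemma finite_syt:
  assumes "finite X"
  shows "finite (syt X)"
proof (rule finite_subset)
  show "syt X \<subseteq> PiE X (\<lambda>_. {1..card X})"
  proof
    fix T assume T: "T \<in> syt X"
    show "T \<in> PiE X (\<lambda>_. {1..card X})"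
    proof (rule PiE_I)
      show "T c \<in> {1..card X}" if "c \<in> X" for c
        using T bij_betw_apply[OF _ that, of T "{1..card X}"] by (simp add: syt_def)
    qed (rule syt_undefined[OF T])
  qed
qed (simp add: assms finite_PiE)

text \<open>As \<open>Y\<close> is closed to the left and upwards, a square \<open>d\<close> outside
  it has no square of \<open>Y\<close> to its right in the same row or below it in the same column.
  A new largest entry at \<open>d\<close> therefore violates no inequality.\<close>

lemma syt_extend:
  assumes Y: "ferrers Y" and d: "d \<notin> Y" and T: "T \<in> syt Y"
  shows "T(d := card (insert d Y)) \<in> syt (insert d Y)"
proof -
  define k where "k = card (insert d Y)"
  have k: "k = Suc (card Y)" using d ferrers_finite[OF Y] by (simp add: k_def)
  have lt: "T c < k" if "c \<in> Y" for c using syt_le[OF T that] k by simp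
  have inc: "T (i, j) < T (i', j')" if "(i, j) \<in> Y" "(i', j') \<in> Y" "i = i' \<and> j < j' \<or> i < i' \<and> j = j'" for i j i' j'
    using T that unfolding syt_def by blast
  have less: "(T(d := k)) (i, j) < (T(d := k)) (i', j')"
    if ij: "(i, j) \<in> insert d Y" "(i', j') \<in> insert d Y"
      and or: "i = i' \<and> j < j' \<or> i < i' \<and> j = j'" for i j i' j'
  proof -
    have ne: "(i, j) \<noteq> (i', j')" using or by auto
    have "d \<noteq> (i, j)"
    proof
      assume "d = (i, j)"
      then have "(i', j') \<in> Y" using ij(2) ne by auto
      then have "(i, j) \<in> Y" using or by (elim ferrersD[OF Y]) auto
      then show False using d \<open>d = (i, j)\<close> by simp
    qed
    then show ?thesis using ij inc[OF _ _ or] lt[of "(i, j)"] by auto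
  qed
  have "bij_betw (T(d := k)) (insert d Y) (insert k {1..card Y})"
  proof -
    have "bij_betw T Y {1..card Y}" using T by (simp add: syt_def)
    then have "bij_betw (T(d := k)) Y {1..card Y}"
      using d by (subst bij_betw_cong[where g = T]) auto
    then show ?thesis
      using notIn_Un_bij_betw[of d Y "T(d := k)" "{1..card Y}"] d k by simp
  qed
  moreover have "insert k {1..card Y} = {1..k}" using k by auto
  moreover have "T(d := k) \<in> extensional (insert d Y)"
    using T by (auto simp: syt_def extensional_def)
  ultimately show ?thesis
    unfolding syt_def k_def[symmetric] using less
    by (simp only: mem_Collect_eq) blast
qed

text \<open>Entries grow to the right and downwards, so the square holding the maximum has nothing
  beyond it and is a removable corner.\<close>

lemma syt_restrict:
  assumes X: "ferrers X" and T: "T \<in> syt X" and d: "d \<in> X" "T d = card X"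
  shows "X - {d} \<in> down X" and "T(d := undefined) \<in> syt (X - {d})"
proof -
  have finX: "finite X" using X by (rule ferrers_finite)
  have bij: "bij_betw T X {1..card X}" using T by (simp add: syt_def)
  \<comment> \<open>Compare through the intermediate square \<open>(i, j')\<close>, which lies in
    \<open>X\<close> by closure: first along a column, then along a row.\<close>
  have mono: "T (i', j') \<le> T (i, j)" if "(i, j) \<in> X" "i' \<le> i" "j' \<le> j" for i j i' j'
  proof -
    have X1: "(i, j') \<in> X" "(i', j') \<in> X" using ferrersD[OF X that(1)] that(2,3) by auto
    have "T (i', j') \<le> T (i, j')"
      using T X1 that(2) by (cases "i' = i") (simp_all add: syt_def less_imp_le)
    also have "\<dots> \<le> T (i, j)"
      using T X1 that(1,3) by (cases "j' = j") (simp_all add: syt_def less_imp_le)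
    finally show ?thesis .
  qed
  have uniq: "c = d" if "c \<in> X" "T c = card X" for c
    using inj_onD[OF bij_betw_imp_inj_on[OF bij]] that d by simp
  have "(i', j') \<in> X - {d}" if ij: "(i, j) \<in> X - {d}" "i' \<le> i" "j' \<le> j" for i j i' j'
  proof -
    have "T (i', j') \<le> T (i, j)" using mono that by simp
    moreover have "T (i, j) < card X"
      using syt_le[OF T, of "(i, j)"] uniq[of "(i, j)"] ij(1) by fastforce
    moreover have "(i', j') \<in> X" using ferrersD[OF X] ij by blast
    ultimately show ?thesis using d(2) by auto
  qed
  then have "ferrers (X - {d})" using finX unfolding ferrers_def by blast
  then show "X - {d} \<in> down X" using d(1) unfolding down_def by blast
  have "bij_betw T (X - {d}) ({1..card X} - {card X})"
  proof -
    have "{card X} \<subseteq> {1..card X}" using d finX by (auto simp: Suc_le_eq card_gt_0_iff)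
    then show ?thesis using bij d by (intro bij_betw_DiffI bij_betw_singletonI) auto
  qed
  moreover have "{1..card X} - {card X} = {1..card (X - {d})}"
    using d(1) finX by auto
  ultimately have "bij_betw T (X - {d}) {1..card (X - {d})}" by simp
  then have "bij_betw (T(d := undefined)) (X - {d}) {1..card (X - {d})}"
    by (subst bij_betw_cong[where g = T]) auto
  then show "T(d := undefined) \<in> syt (X - {d})"
    using T by (simp add: syt_def extensional_def)
qed

text \<open>A filling amounts to the position of its largest entry together with the filling of the
  rest. The position is encoded by the smaller shape \<open>Y\<close>, as the only element of
  \<open>X - Y\<close>.\<close>

lemma bij_betw_syt:
  assumes X: "ferrers X" and ne: "X \<noteq> {}"
  shows "bij_betw (\<lambda>(Y, T). \<lambda>c. if c \<in> X - Y then card X else T c) (SIGMA Y:down X. syt Y) (syt X)"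
    (is "bij_betw ?f ?S _")
proof -
  \<comment> \<open>The default \<open>undefined\<close> is itself some natural number and may equal
    \<open>card X\<close>. This does no harm: off \<open>X\<close> the test then replaces
    \<open>undefined\<close> by itself, and the first component looks only at squares of
    \<open>X\<close>.\<close>
  define g where "g T = ({c \<in> X. T c \<noteq> card X}, \<lambda>c. if T c = card X then undefined else T c)"
    for T :: "nat \<times> nat \<Rightarrow> nat"
  have fin: "finite X" using X by (rule ferrers_finite)
  have down: "\<exists>d. d \<notin> Y \<and> X = insert d Y \<and> ferrers Y \<and> ?f (Y, T) = T(d := card X)"
    if down: "Y \<in> down X" for Y T
  proof -
    obtain d where d: "d \<notin> Y" "X = insert d Y" "ferrers Y" using down unfolding down_def by blast
    then have "X - Y = {d}" by blast
    then have "c \<in> X - Y \<longleftrightarrow> c = d" for c by blast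
    then have "?f (Y, T) = T(d := card X)" by (simp only: fun_upd_def prod.case)
    then show ?thesis using d by blast
  qed
  show ?thesis
  proof (rule bij_betw_byWitness[where f' = g])
    show "\<forall>a\<in>?S. g (?f a) = a"
    proof
      fix a assume "a \<in> ?S"
      then obtain Y T where a: "a = (Y, T)" and Y: "Y \<in> down X" and T: "T \<in> syt Y" by blast
      obtain d where d: "d \<notin> Y" "X = insert d Y" and f: "?f (Y, T) = T(d := card X)"
        using down[OF Y] by blast
      have "card X = Suc (card Y)" using d fin by simp
      then have lt: "T c < card X" if "c \<in> Y" for c using syt_le[OF T that] by simp
      have und: "T c = undefined" if "c \<notin> Y" for c using syt_undefined[OF T that] .
      have "{c \<in> X. (T(d := card X)) c \<noteq> card X} = {c \<in> Y. T c \<noteq> card X}"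
        using d by auto
      also have "T c \<noteq> card X" if "c \<in> Y" for c using lt[OF that] by simp
      then have "{c \<in> Y. T c \<noteq> card X} = Y" by blast
      finally have 1: "{c \<in> X. (T(d := card X)) c \<noteq> card X} = Y" .
      have "(if (T(d := card X)) c = card X then undefined else (T(d := card X)) c) = T c" for c
        using lt[of c] und[of c] und[OF d(1)] by (cases "c = d"; cases "c \<in> Y") auto
      then show "g (?f a) = a" unfolding a f g_def 1 by simp
    qed
    show "\<forall>T\<in>syt X. ?f (g T) = T"
    proof
      fix T assume T: "T \<in> syt X"
      have "?f (g T) c = T c" for c
        using syt_undefined[OF T, of c] by (cases "c \<in> X") (simp_all add: g_def)
      then show "?f (g T) = T" by (rule ext)
    qed
    show "?f ` ?S \<subseteq> syt X"
    proof (intro image_subsetI)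
      fix a assume "a \<in> ?S"
      then obtain Y T where a: "a = (Y, T)" and Y: "Y \<in> down X" and T: "T \<in> syt Y" by blast
      obtain d where d: "d \<notin> Y" "X = insert d Y" "ferrers Y" and f: "?f (Y, T) = T(d := card X)"
        using down[OF Y] by blast
      show "?f a \<in> syt X" unfolding a f using syt_extend[OF d(3,1) T] d(2) by simp
    qed
    show "g ` syt X \<subseteq> ?S"
    proof (intro image_subsetI)
      fix T assume T: "T \<in> syt X"
      have bij: "bij_betw T X {1..card X}" using T by (simp add: syt_def)
      have "card X \<in> {1..card X}" using ne fin by (simp add: Suc_leI card_gt_0_iff)
      then obtain d where d: "d \<in> X" "T d = card X"
        using bij_betw_imp_surj_on[OF bij] by (metis imageE)
      have uniq: "T c = card X \<longleftrightarrow> c = d" if "c \<in> X" for c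
        using inj_onD[OF bij_betw_imp_inj_on[OF bij], of c d] that d by auto
      have "{c \<in> X. T c \<noteq> card X} = X - {d}" using uniq by auto
      moreover have "(if T c = card X then undefined else T c) = (T(d := undefined)) c" for c
        using uniq[of c] d syt_undefined[OF T, of c] by (cases "c \<in> X") auto
      ultimately have "g T = (X - {d}, T(d := undefined))" unfolding g_def by (simp add: fun_upd_def)
      then show "g T \<in> ?S" using syt_restrict[OF X T d] by simp
    qed
  qed
qed

text \<open>Deleting the largest entry sorts the fillings by the remaining shape. The empty shape is
  excluded because it has one filling but no square to delete.\<close>

lemma card_syt_rec:
  assumes X: "ferrers X" and ne: "X \<noteq> {}"
  shows "card (syt X) = (\<Sum>Y\<in>down X. card (syt Y))"
proof -
  have "card (syt X) = card (SIGMA Y:down X. syt Y)"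
    using bij_betw_same_card[OF bij_betw_syt[OF assms]] by simp
  also have "\<dots> = (\<Sum>Y\<in>down X. card (syt Y))"
    using finite_down[OF X] by (intro card_SigmaI ballI finite_syt ferrers_finite) (simp_all add: down_def)
  finally show ?thesis .
qed

text \<open>Expand each summand by \<open>card_syt_rec\<close> and exchange up and down by
  \<open>up_down_sum\<close>. Every \<open>W\<close> below \<open>X\<close> has one square less, so
  by induction its inner sum is \<open>card X * card (syt W)\<close>, and
  \<open>card_syt_rec\<close> sums these up.\<close>

lemma sum_up_card_syt:
  "ferrers X \<Longrightarrow> (\<Sum>Y\<in>up X. card (syt Y)) = Suc (card X) * card (syt X)"
proof (induction "card X" arbitrary: X rule: less_induct)
  case less
  note X = less.prems
  have "(\<Sum>Y\<in>up X. card (syt Y)) = (\<Sum>Y\<in>up X. \<Sum>Z\<in>down Y. card (syt Z))"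
    by (intro sum.cong refl card_syt_rec) (unfold up_def, blast+)
  also have "\<dots> = card (syt X) + (\<Sum>W\<in>down X. \<Sum>Z\<in>up W. card (syt Z))"
    by (rule up_down_sum[OF X])
  also have "(\<Sum>W\<in>down X. \<Sum>Z\<in>up W. card (syt Z)) = (\<Sum>W\<in>down X. card X * card (syt W))"
  proof (intro sum.cong refl)
    fix W assume "W \<in> down X"
    then obtain c where W: "ferrers W" and c: "c \<notin> W" "X = insert c W" unfolding down_def by blast
    then have "card X = Suc (card W)" using ferrers_finite by simp
    then show "(\<Sum>Z\<in>up W. card (syt Z)) = card X * card (syt W)" using less.hyps[of W] W by simp
  qed
  also have "\<dots> = card X * card (syt X)"
    using card_syt_rec[OF X] by (cases "X = {}") (simp_all add: sum_distrib_left down_def)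
  finally show ?case by simp
qed

section \<open>Integer partitions and vacillating tableaux\<close>

lemma young_diagram_eq_Sigma: "young_diagram lam = (SIGMA i:{..<length lam}. {..<lam ! i})"
  by (auto simp: young_diagram_def)

lemma card_young_diagram: "card (young_diagram lam) = sum_list lam"
  by (simp add: young_diagram_eq_Sigma sum_list_sum_nth atLeast0LessThan)

lemma ferrers_young_diagram:
  assumes "int_partition lam"
  shows "ferrers (young_diagram lam)"
proof -
  have "lam ! i \<le> lam ! i'" if "i' \<le> i" "i < length lam" for i i'
    using assms that sorted_wrt_nth_less[of "(\<ge>)" lam i' i] unfolding int_partition_def
    by (cases "i' = i") simp_all
  then have "(i', j') \<in> young_diagram lam" if "(i, j) \<in> young_diagram lam" "i' \<le> i" "j' \<le> j" for i j i' j'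
    using that by (fastforce simp: young_diagram_def)
  moreover have "finite (young_diagram lam)" by (simp add: young_diagram_eq_Sigma)
  ultimately show ?thesis unfolding ferrers_def by blast
qed

text \<open>Since no part is zero, the first column shows the number of parts; each row then shows
  its part.\<close>

lemma young_diagram_inj:
  assumes "int_partition lam" "int_partition \<mu>" "young_diagram lam = young_diagram \<mu>"
  shows "lam = \<mu>"
proof -
  have pos: "i < length k \<longleftrightarrow> (i, 0) \<in> young_diagram k" if "int_partition k" for i and k :: "nat list"
  proof
    assume "i < length k"
    then have "k ! i \<in> set k" by simp
    then have "k ! i \<noteq> 0" using that unfolding int_partition_def by metis
    then show "(i, 0) \<in> young_diagram k" using \<open>i < length k\<close> by (simp add: young_diagram_def)
  qed (simp add: young_diagram_def)
  have "i < length lam \<longleftrightarrow> i < length \<mu>" for i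
    using pos[OF assms(1)] pos[OF assms(2)] assms(3) by simp
  then have len: "length lam = length \<mu>" by (metis less_irrefl linorder_neqE_nat)
  have "lam ! i = \<mu> ! i" if "i < length lam" for i
  proof -
    have "{j. (i, j) \<in> young_diagram lam} = {..<lam ! i}" "{j. (i, j) \<in> young_diagram \<mu>} = {..<\<mu> ! i}"
      using that len by (auto simp: young_diagram_def)
    then show ?thesis using assms(3) by (metis lessThan_eq_iff)
  qed
  then show ?thesis using len by (intro nth_equalityI)
qed

text \<open>The lengths of the nonempty rows, of which there are as many as squares in the first
  column, are weakly decreasing and positive.\<close>

lemma young_diagram_surj:
  assumes X: "ferrers X"
  obtains lam where "int_partition lam" "young_diagram lam = X"
proof -
  define n where "n = card {i. (i, 0) \<in> X}"
  have "{i. (i, 0) \<in> X} = {..<n}"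
    unfolding n_def
  proof (rule finite_initial_segment)
    have "{i. (i, 0) \<in> X} \<subseteq> fst ` X" by (force intro: rev_image_eqI)
    then show "finite {i. (i, 0) \<in> X}" using ferrers_finite[OF X] by (rule finite_subset[OF _ finite_imageI])
  qed (use ferrersD[OF X] in blast)
  then have n: "(i, 0) \<in> X \<longleftrightarrow> i < n" for i by blast
  define lam where "lam = map (row X) [0..<n]"
  have pos: "row X i \<noteq> 0" if "i < n" for i
    using n[of i] mem_iff_row[OF X, of i 0] that by simp
  have "int_partition lam"
    using pos row_antimono[OF X]
    by (fastforce simp: int_partition_def lam_def sorted_wrt_iff_nth_less)
  moreover have "(i, j) \<in> young_diagram lam \<longleftrightarrow> (i, j) \<in> X" for i j
  proof -
    have "(i, j) \<in> X \<Longrightarrow> i < n" using ferrersD[OF X, of i j i 0] n by simp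
    then show ?thesis using mem_iff_row[OF X, of i j] by (auto simp: young_diagram_def lam_def)
  qed
  then have "young_diagram lam = X" by auto
  ultimately show ?thesis using that by blast
qed

text \<open>Together with its upward counterpart this turns sums over neighbouring partitions into
  sums over \<open>down\<close> and \<open>up\<close>, where the commutation relation lives.\<close>

lemma bij_betw_young_diagram_down:
  "bij_betw young_diagram {\<mu>. int_partition \<mu> \<and> adds_square \<mu> lam} (down (young_diagram lam))"
proof (rule bij_betw_imageI)
  show "inj_on young_diagram {\<mu>. int_partition \<mu> \<and> adds_square \<mu> lam}"
    by (rule inj_onI) (use young_diagram_inj in blast)
  show "young_diagram ` {\<mu>. int_partition \<mu> \<and> adds_square \<mu> lam} = down (young_diagram lam)"
  proof (intro equalityI image_subsetI subsetI)
    fix Y assume Y: "Y \<in> down (young_diagram lam)"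
    then have "ferrers Y" by (simp add: down_def)
    then obtain \<mu> where "int_partition \<mu>" "young_diagram \<mu> = Y" by (rule young_diagram_surj)
    then show "Y \<in> young_diagram ` {\<mu>. int_partition \<mu> \<and> adds_square \<mu> lam}"
      using Y unfolding down_def adds_square_def by blast
  qed (use ferrers_young_diagram in \<open>simp add: down_def adds_square_def\<close>)
qed

lemma bij_betw_young_diagram_up:
  "bij_betw young_diagram {\<nu>. int_partition \<nu> \<and> adds_square \<mu> \<nu>} (up (young_diagram \<mu>))"
proof (rule bij_betw_imageI)
  show "inj_on young_diagram {\<nu>. int_partition \<nu> \<and> adds_square \<mu> \<nu>}"
    by (rule inj_onI) (use young_diagram_inj in blast)
  show "young_diagram ` {\<nu>. int_partition \<nu> \<and> adds_square \<mu> \<nu>} = up (young_diagram \<mu>)"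
  proof (intro equalityI image_subsetI subsetI)
    fix Y assume Y: "Y \<in> up (young_diagram \<mu>)"
    then have "ferrers Y" by (simp add: up_def)
    then obtain \<nu> where "int_partition \<nu>" "young_diagram \<nu> = Y" by (rule young_diagram_surj)
    then show "Y \<in> young_diagram ` {\<nu>. int_partition \<nu> \<and> adds_square \<mu> \<nu>}"
      using Y unfolding up_def adds_square_def by blast
  qed (use ferrers_young_diagram in \<open>simp add: up_def adds_square_def\<close>)
qed

lemma num_SYT_eq: "num_SYT lam = card (syt (young_diagram lam))"
  by (simp add: num_SYT_def standard_young_tableaux_def syt_def card_young_diagram)

section \<open>Recursion for vacillating tableaux\<close>

lemma not_adds_square_self: "\<not> adds_square \<mu> \<mu>"
  by (auto simp: adds_square_def)

text \<open>The prefix \<open>p\<close> fills positions \<open>0\<close> to \<open>2 * n\<close> and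
  ends in \<open>\<nu>\<close>; the last two steps go down from \<open>\<nu>\<close> to
  \<open>\<mu>\<close> and up from \<open>\<mu>\<close> to \<open>lam\<close>.\<close>

lemma append_mem_vacillating_tableaux_iff:
  assumes p: "length p = 2 * n + 1"
  shows "p @ [\<mu>, lam'] \<in> vacillating_tableaux lam (Suc n) \<longleftrightarrow>
    lam' = lam \<and> int_partition lam \<and> int_partition \<mu> \<and> (lam = \<mu> \<or> adds_square \<mu> lam) \<and>
    (\<exists>\<nu>. int_partition \<nu> \<and> (\<mu> = \<nu> \<or> adds_square \<mu> \<nu>) \<and> p \<in> vacillating_tableaux \<nu> n)"
proof -
  define L where "L = p @ [\<mu>, lam']"
  have nth: "L ! i = p ! i" if "i \<le> 2 * n" for i using that p by (simp add: L_def nth_append)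
  have nth1: "L ! (2 * n + 1) = \<mu>" and nth2: "L ! (2 * n + 2) = lam'" using p by (simp_all add: L_def nth_append)
  have odd: "(\<forall>i<Suc n. L ! (2 * i + 1) = L ! (2 * i) \<or> adds_square (L ! (2 * i + 1)) (L ! (2 * i))) \<longleftrightarrow>
      (\<forall>i<n. p ! (2 * i + 1) = p ! (2 * i) \<or> adds_square (p ! (2 * i + 1)) (p ! (2 * i))) \<and>
      (\<mu> = p ! (2 * n) \<or> adds_square \<mu> (p ! (2 * n)))"
    using nth nth1 by (auto simp: less_Suc_eq)
  have ev: "(\<forall>i\<in>{1..Suc n}. L ! (2 * i) = L ! (2 * i - 1) \<or> adds_square (L ! (2 * i - 1)) (L ! (2 * i))) \<longleftrightarrow>
      (\<forall>i\<in>{1..n}. p ! (2 * i) = p ! (2 * i - 1) \<or> adds_square (p ! (2 * i - 1)) (p ! (2 * i))) \<and>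
      (lam' = \<mu> \<or> adds_square \<mu> lam')"
  proof -
    have "L ! (2 * i) = p ! (2 * i)" "L ! (2 * i - 1) = p ! (2 * i - 1)" if "i \<in> {1..n}" for i
      using that by (auto intro!: nth)
    then have "(\<forall>i\<in>{1..n}. L ! (2 * i) = L ! (2 * i - 1) \<or> adds_square (L ! (2 * i - 1)) (L ! (2 * i))) \<longleftrightarrow>
        (\<forall>i\<in>{1..n}. p ! (2 * i) = p ! (2 * i - 1) \<or> adds_square (p ! (2 * i - 1)) (p ! (2 * i)))"
      by (intro ball_cong refl) simp
    moreover have "{1..Suc n} = insert (Suc n) {1..n}" by auto
    ultimately show ?thesis using nth1 nth2 by auto
  qed
  have mem: "p ! (2 * n) \<in> set p" using p by simp
  \<comment> \<open>\<open>P\<close> and \<open>Q\<close> name the conditions on the prefix, which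
    occur unchanged on both sides.\<close>
  define P where "P \<longleftrightarrow> (\<forall>i<n. p ! (2 * i + 1) = p ! (2 * i) \<or> adds_square (p ! (2 * i + 1)) (p ! (2 * i)))"
  define Q where "Q \<longleftrightarrow> (\<forall>i\<in>{1..n}. p ! (2 * i) = p ! (2 * i - 1) \<or> adds_square (p ! (2 * i - 1)) (p ! (2 * i)))"
  have "length L = 2 * Suc n + 1" "L ! 0 = p ! 0" "L ! (2 * Suc n) = lam'" "set L = set p \<union> {\<mu>, lam'}"
    using p nth[of 0] nth2 by (simp_all add: L_def)
  then show ?thesis
    unfolding L_def[symmetric] vacillating_tableaux_def mem_Collect_eq odd ev
      P_def[symmetric] Q_def[symmetric]
    using p mem by auto
qed

text \<open>Recording \<open>\<nu>\<close> makes the domain a nested dependent sum that can be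
  counted layer by layer. It costs no injectivity, because \<open>\<nu>\<close> is the last term of
  \<open>p\<close>.\<close>

lemma vacillating_tableaux_Suc:
  assumes lam: "int_partition lam"
  shows "bij_betw (\<lambda>(\<mu>, \<nu>, p). p @ [\<mu>, lam])
    (SIGMA \<mu>:insert lam {\<mu>. int_partition \<mu> \<and> adds_square \<mu> lam}.
     SIGMA \<nu>:insert \<mu> {\<nu>. int_partition \<nu> \<and> adds_square \<mu> \<nu>}. vacillating_tableaux \<nu> n)
    (vacillating_tableaux lam (Suc n))" (is "bij_betw ?f ?S ?T")
proof (rule bij_betw_imageI)
  have len: "length p = 2 * n + 1" and last: "p ! (2 * n) = \<nu>" if "p \<in> vacillating_tableaux \<nu> n" for p \<nu>
    using that by (simp_all add: vacillating_tableaux_def)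
  show "inj_on ?f ?S"
    by (intro inj_onI) (auto dest!: last)
  show "?f ` ?S = ?T"
  proof (intro equalityI image_subsetI subsetI)
    fix a assume "a \<in> ?S"
    then show "?f a \<in> ?T"
      using lam append_mem_vacillating_tableaux_iff[OF len] by (cases a) auto
  next
    fix L assume L: "L \<in> ?T"
    then have l: "length L = 2 * n + 3" by (simp add: vacillating_tableaux_def)
    define p where "p = take (2 * n + 1) L"
    have Lp: "L = p @ [L ! (2 * n + 1), L ! (2 * n + 2)]"
    proof -
      have "drop (2 * n + 1) L = [L ! (2 * n + 1), L ! (2 * n + 2)]"
        using l Cons_nth_drop_Suc[of "2 * n + 1" L] Cons_nth_drop_Suc[of "2 * n + 2" L] by simp
      then show ?thesis unfolding p_def by (metis append_take_drop_id)
    qed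
    have "length p = 2 * n + 1" using l by (simp add: p_def)
    from append_mem_vacillating_tableaux_iff[OF this, of "L ! (2 * n + 1)" "L ! (2 * n + 2)" lam]
    obtain \<mu> \<nu> where "L = p @ [\<mu>, lam]" "int_partition \<mu>" "lam = \<mu> \<or> adds_square \<mu> lam"
      "int_partition \<nu>" "\<mu> = \<nu> \<or> adds_square \<mu> \<nu>" "p \<in> vacillating_tableaux \<nu> n"
      using L Lp by metis
    then show "L \<in> ?f ` ?S" by (intro image_eqI[of _ _ "(\<mu>, \<nu>, p)"]) auto
  qed
qed

lemma finite_adds_square:
  assumes "int_partition lam"
  shows "finite {\<mu>. int_partition \<mu> \<and> adds_square \<mu> lam}"
    and "finite {\<nu>. int_partition \<nu> \<and> adds_square lam \<nu>}"
  using bij_betw_finite[OF bij_betw_young_diagram_down[of lam]]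
    bij_betw_finite[OF bij_betw_young_diagram_up[of lam]]
    finite_down[OF ferrers_young_diagram[OF assms]] finite_up[OF ferrers_young_diagram[OF assms]]
  by simp_all

lemma vacillating_tableaux_0: "vacillating_tableaux lam 0 = (if lam = [] then {[[]]} else {})"
  by (auto simp: vacillating_tableaux_def length_Suc_conv int_partition_def)

lemma finite_vacillating_tableaux: "int_partition lam \<Longrightarrow> finite (vacillating_tableaux lam n)"
proof (induction n arbitrary: lam)
  case (Suc n)
  then show ?case
    unfolding bij_betw_finite[OF vacillating_tableaux_Suc[OF Suc.prems, of n], symmetric]
    by (intro finite_SigmaI finite.insertI finite_adds_square) auto
qed (simp add: vacillating_tableaux_0)

lemma num_vacillating_Suc:
  assumes lam: "int_partition lam"
  shows "num_vacillating lam (Suc n) =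
    (\<Sum>\<mu>\<in>insert lam {\<mu>. int_partition \<mu> \<and> adds_square \<mu> lam}.
     \<Sum>\<nu>\<in>insert \<mu> {\<nu>. int_partition \<nu> \<and> adds_square \<mu> \<nu>}. num_vacillating \<nu> n)"
proof -
  have fin: "finite (SIGMA \<nu>:insert \<mu> {\<nu>. int_partition \<nu> \<and> adds_square \<mu> \<nu>}. vacillating_tableaux \<nu> n)"
    and card: "card (SIGMA \<nu>:insert \<mu> {\<nu>. int_partition \<nu> \<and> adds_square \<mu> \<nu>}. vacillating_tableaux \<nu> n) =
      (\<Sum>\<nu>\<in>insert \<mu> {\<nu>. int_partition \<nu> \<and> adds_square \<mu> \<nu>}. num_vacillating \<nu> n)"
    if \<mu>: "int_partition \<mu>" for \<mu>
  proof -
    let ?U = "insert \<mu> {\<nu>. int_partition \<nu> \<and> adds_square \<mu> \<nu>}"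
    have "finite ?U" "\<forall>\<nu>\<in>?U. finite (vacillating_tableaux \<nu> n)"
      using \<mu> finite_adds_square(2)[OF \<mu>] finite_vacillating_tableaux by auto
    then show "finite (SIGMA \<nu>:?U. vacillating_tableaux \<nu> n)"
      "card (SIGMA \<nu>:?U. vacillating_tableaux \<nu> n) = (\<Sum>\<nu>\<in>?U. num_vacillating \<nu> n)"
      unfolding num_vacillating_def by (blast intro: finite_SigmaI, rule card_SigmaI)
  qed
  let ?D = "insert lam {\<mu>. int_partition \<mu> \<and> adds_square \<mu> lam}"
  have "int_partition \<mu>" if "\<mu> \<in> ?D" for \<mu> using that lam by auto
  note D = fin[OF this] card[OF this]
  have "finite ?D" using finite_adds_square(1)[OF lam] by simp
  then show ?thesis
    unfolding num_vacillating_def[of lam] bij_betw_same_card[OF vacillating_tableaux_Suc[OF lam], symmetric]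
    by (subst card_SigmaI) (use D in \<open>blast, blast, intro sum.cong refl, blast\<close>)
qed

section \<open>The product formula for vacillating tableaux\<close>

lemma num_vacillating_eq:
  "int_partition lam \<Longrightarrow> num_vacillating lam n = num_distinguished n (sum_list lam) * num_SYT lam"
proof (induction n arbitrary: lam)
  case 0
  then have "sum_list lam = 0 \<longleftrightarrow> lam = []" by (cases lam) (auto simp: int_partition_def)
  moreover have "num_SYT [] = 1"
    using card_syt_empty by (simp add: num_SYT_eq young_diagram_def)
  ultimately show ?case
    by (simp add: num_vacillating_def vacillating_tableaux_0 num_distinguished_0)
next
  case (Suc n)
  define F where "F X = card (syt X)" for X
  \<comment> \<open>\<open>H m\<close> is the coefficient of \<open>F\<close> at a shape
    \<open>\<mu>\<close> of size \<open>m\<close> after the sum over \<open>\<nu>\<close>: standing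
    still gives the first term, and the covers of \<open>\<mu>\<close> give the second by
    \<open>sum_up_card_syt\<close>.\<close>
  define H where "H m = num_distinguished n m + Suc m * num_distinguished n (Suc m)" for m
  have IH: "num_vacillating \<nu> n = num_distinguished n (card (young_diagram \<nu>)) * F (young_diagram \<nu>)"
    if "int_partition \<nu>" for \<nu>
    using Suc.IH[OF that] by (simp add: F_def num_SYT_eq card_young_diagram)
  have inner: "(\<Sum>\<nu>\<in>insert \<mu> {\<nu>. int_partition \<nu> \<and> adds_square \<mu> \<nu>}. num_vacillating \<nu> n) =
      H (card (young_diagram \<mu>)) * F (young_diagram \<mu>)" if \<mu>: "int_partition \<mu>" for \<mu>
  proof -
    let ?X = "young_diagram \<mu>"
    have X: "ferrers ?X" using \<mu> by (rule ferrers_young_diagram)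
    have "(\<Sum>\<nu> | int_partition \<nu> \<and> adds_square \<mu> \<nu>. num_vacillating \<nu> n) =
        (\<Sum>\<nu> | int_partition \<nu> \<and> adds_square \<mu> \<nu>.
          num_distinguished n (card (young_diagram \<nu>)) * F (young_diagram \<nu>))"
      using IH by (intro sum.cong) auto
    also have "\<dots> = (\<Sum>Y\<in>up ?X. num_distinguished n (card Y) * F Y)"
      by (rule sum.reindex_bij_betw[OF bij_betw_young_diagram_up])
    also have "\<dots> = (\<Sum>Y\<in>up ?X. num_distinguished n (Suc (card ?X)) * F Y)"
      using ferrers_finite[OF X] by (intro sum.cong refl) (auto simp: up_def)
    also have "\<dots> = num_distinguished n (Suc (card ?X)) * (Suc (card ?X) * F ?X)"
      unfolding F_def sum_up_card_syt[OF X, symmetric] by (simp add: sum_distrib_left)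
    finally show ?thesis
      \<comment> \<open>Standing still and moving by a square exclude each other, so the sum over
        \<open>insert\<close> splits.\<close>
      using finite_adds_square(2)[OF \<mu>] IH[OF \<mu>]
      by (simp add: not_adds_square_self H_def algebra_simps)
  qed
  let ?X = "young_diagram lam"
  have X: "ferrers ?X" using Suc.prems by (rule ferrers_young_diagram)
  have "(\<Sum>\<mu> | int_partition \<mu> \<and> adds_square \<mu> lam. H (card (young_diagram \<mu>)) * F (young_diagram \<mu>)) =
      (\<Sum>Y\<in>down ?X. H (card Y) * F Y)"
    by (rule sum.reindex_bij_betw[OF bij_betw_young_diagram_down])
  also have "\<dots> = (\<Sum>Y\<in>down ?X. H (card ?X - 1) * F Y)"
    using ferrers_finite[OF X] by (intro sum.cong refl) (auto simp: down_def)
  also have "\<dots> = H (card ?X - 1) * (\<Sum>Y\<in>down ?X. F Y)"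
    by (simp add: sum_distrib_left)
  \<comment> \<open>The empty shape has nothing below it; the conditional suppresses the spurious
    \<open>H (0 - 1)\<close>.\<close>
  also have "\<dots> = (if card ?X = 0 then 0 else H (card ?X - 1)) * F ?X"
    using card_syt_rec[OF X] ferrers_finite[OF X]
    by (cases "?X = {}") (simp_all add: F_def down_def)
  finally have lower: "(\<Sum>\<mu> | int_partition \<mu> \<and> adds_square \<mu> lam. H (card (young_diagram \<mu>)) * F (young_diagram \<mu>)) =
      (if card ?X = 0 then 0 else H (card ?X - 1)) * F ?X" .
  have "num_vacillating lam (Suc n) =
      (\<Sum>\<mu>\<in>insert lam {\<mu>. int_partition \<mu> \<and> adds_square \<mu> lam}. H (card (young_diagram \<mu>)) * F (young_diagram \<mu>))"
    unfolding num_vacillating_Suc[OF Suc.prems] using inner Suc.prems by (intro sum.cong refl) auto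
  also have "\<dots> = H (card ?X) * F ?X + (if card ?X = 0 then 0 else H (card ?X - 1)) * F ?X"
    unfolding lower[symmetric] using finite_adds_square(1)[OF Suc.prems]
    by (simp add: not_adds_square_self)
  \<comment> \<open>For \<open>k > 0\<close>, \<open>H k + H (k - 1)\<close> is
    \<open>B(n, k-1) + (k+1) B(n, k) + (k+1) B(n, k+1)\<close>: one copy of \<open>B(n, k)\<close>
    comes from \<open>H k\<close> and \<open>k\<close> copies from \<open>H (k - 1)\<close>.\<close>
  also have "\<dots> = num_distinguished (Suc n) (card ?X) * F ?X"
    by (cases "card ?X") (simp_all add: num_distinguished_Suc H_def algebra_simps)
  finally show ?case by (simp add: F_def num_SYT_eq card_young_diagram)
qed

theorem theorem5:
  shows "(\<forall>lam k n. int_partition_of lam k \<longrightarrow>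
            num_vacillating lam n = num_distinguished n k * num_SYT lam) \<and>
    (\<forall>k. Abs_fps (\<lambda>n. of_nat (num_distinguished n k) / fact n :: 'a::field_char_0) =
       fps_const (1 / fact k) * (fps_exp 1 - 1) ^ k * (fps_exp 1 oo (fps_exp 1 - 1)))"
  by (auto simp: int_partition_of_def num_vacillating_eq fps_num_distinguished)

end
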